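(* Any online algorithm that has the MRU property is $4$ access-competitive: for every request sequence $\sigma$, the total access cost of the algorithm on $\sigma$ is at most $4\cdot\mathrm{cost}(\textsc{Opt}(\sigma))$.
   Context: Self-adjusting complete tree model: a set $V$ of $n$ items is stored in a complete binary tree of $n$ servers, one item per server; the root has depth $0$ and an item's depth is that of its hosting server. Requests $\sigma=(\sigma^{(1)},\sigma^{(2)},\dots)$ to items are revealed online and originate at the root. Serving a request to an item at depth $d$ costs $d$ (access cost); a swap, exchanging the items of a server and its parent, costs $1$ (adjustment cost). $\mathrm{cost}(\textsc{Opt}(\sigma))$ is the total access plus adjustment cost of an optimal offline algorithm that knows $\sigma$ in advance. The rank of item $v$ at time $t$ is the number of distinct items requested since the last request of $v$ before $t$, including $v$. A tree is an MRU tree at time $t$ if every item $v$ has depth exactly $\lfloor\log_2 v.\mathrm{rank}\rfloor$. An online algorithm has the MRU property if the tree it maintains is an MRU tree at every time $t$. *)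

theory Defs
  imports Complex_Main "HOL-Combinatorics.Transposition"
begin

(* The n servers are the numbers 1, ..., n in heap order: 1 is the root and the
   parent of server i >= 2 is server i div 2. *)

definition parent :: "nat \<Rightarrow> nat" where
  "parent i = i div 2"

function depth :: "nat \<Rightarrow> nat" where
  "depth i = (if i \<le> 1 then 0 else Suc (depth (parent i)))"
  by auto
termination by (relation "measure id") (auto simp: parent_def)

declare depth.simps [simp del]

(* A tree is given by the map sending each item to its hosting server. *)

type_synonym 'a tree = "'a \<Rightarrow> nat"

definition is_tree :: "'a set \<Rightarrow> nat \<Rightarrow> 'a tree \<Rightarrow> bool" where
  "is_tree V n T \<longleftrightarrow> bij_betw T V {1..n}"

(* Exchange the items of server i and its parent; only used for i in {2..n}. *)

definition swap :: "nat \<Rightarrow> 'a tree \<Rightarrow> 'a tree" where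
  "swap i T = transpose i (parent i) \<circ> T"

(* "serves n T \<sigma> c": from tree T, the requests \<sigma> can be served with total
   (access plus adjustment) cost c. Swaps may be made at any moment, in particular
   before the first access. *)

inductive serves :: "nat \<Rightarrow> 'a tree \<Rightarrow> 'a list \<Rightarrow> nat \<Rightarrow> bool" for n where
  finished: "serves n T [] 0"
| access: "serves n T \<sigma> c \<Longrightarrow> serves n T (v # \<sigma>) (depth (T v) + c)"
| adjust: "i \<in> {2..n} \<Longrightarrow> serves n (swap i T) \<sigma> c \<Longrightarrow> serves n T \<sigma> (1 + c)"

definition opt_cost :: "nat \<Rightarrow> 'a tree \<Rightarrow> 'a list \<Rightarrow> nat" where
  "opt_cost n T\<^sub>0 \<sigma> = (LEAST c. serves n T\<^sub>0 \<sigma> c)"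

lemma serves_static: "serves n T \<sigma> (\<Sum>v\<leftarrow>\<sigma>. depth (T v))"
  by (induction \<sigma>) (auto intro: serves.intros)

lemma serves_opt_cost: "serves n T \<sigma> (opt_cost n T \<sigma>)"
  unfolding opt_cost_def by (rule LeastI, rule serves_static)

(* An online algorithm maps the requests revealed so far to the list of swaps
   (each named by its child server) made after serving the latest of them. *)

type_synonym 'a online_alg = "'a list \<Rightarrow> nat list"

definition is_online_alg :: "'a set \<Rightarrow> nat \<Rightarrow> 'a online_alg \<Rightarrow> bool" where
  "is_online_alg V n A \<longleftrightarrow> (\<forall>\<sigma>. set \<sigma> \<subseteq> V \<longrightarrow> set (A \<sigma>) \<subseteq> {2..n})"

(* The tree maintained after the first t requests of \<sigma>; the request \<sigma> ! t is served in it. *)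

primrec tree_at :: "'a online_alg \<Rightarrow> 'a tree \<Rightarrow> 'a list \<Rightarrow> nat \<Rightarrow> 'a tree" where
  "tree_at A T\<^sub>0 \<sigma> 0 = T\<^sub>0"
| "tree_at A T\<^sub>0 \<sigma> (Suc t) = fold swap (A (take (Suc t) \<sigma>)) (tree_at A T\<^sub>0 \<sigma> t)"

definition access_cost :: "'a online_alg \<Rightarrow> 'a tree \<Rightarrow> 'a list \<Rightarrow> nat" where
  "access_cost A T\<^sub>0 \<sigma> = (\<Sum>t<length \<sigma>. depth (tree_at A T\<^sub>0 \<sigma> t (\<sigma> ! t)))"

(* hs lists all past requests, oldest first. *)

definition rank :: "'a list \<Rightarrow> 'a \<Rightarrow> nat" where
  "rank hs v = card (insert v (set (takeWhile (\<lambda>u. u \<noteq> v) (rev hs))))"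

definition is_MRU_tree :: "'a set \<Rightarrow> 'a list \<Rightarrow> 'a tree \<Rightarrow> bool" where
  "is_MRU_tree V hs T \<longleftrightarrow> (\<forall>v\<in>V. int (depth (T v)) = \<lfloor>log 2 (real (rank hs v))\<rfloor>)"

(* Ranks at the beginning refer to a past h (every item of V occurs in h when this is used),
   so that the rank of an item not yet requested in \<sigma> is meaningful. *)

definition has_MRU_property ::
  "'a set \<Rightarrow> 'a list \<Rightarrow> 'a tree \<Rightarrow> 'a online_alg \<Rightarrow> bool" where
  "has_MRU_property V h T\<^sub>0 A \<longleftrightarrow>
     (\<forall>\<sigma>. set \<sigma> \<subseteq> V \<longrightarrow>
        (\<forall>t\<le>length \<sigma>. is_MRU_tree V (h @ take t \<sigma>) (tree_at A T\<^sub>0 \<sigma> t)))"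

(* The optimal offline algorithm starts from the same initial tree; there is no additive constant. *)

definition access_competitive ::
  "real \<Rightarrow> 'a set \<Rightarrow> nat \<Rightarrow> 'a tree \<Rightarrow> 'a online_alg \<Rightarrow> bool" where
  "access_competitive c V n T\<^sub>0 A \<longleftrightarrow>
     (\<forall>\<sigma>. set \<sigma> \<subseteq> V \<longrightarrow> real (access_cost A T\<^sub>0 \<sigma>) \<le> c * real (opt_cost n T\<^sub>0 \<sigma>))"

end

(* Amortized analysis with the potential
     Phi = sum over items w of log2 (1 + b(w) / 2^d(w)),
   where d is the depth in Opt's tree and b(w) counts the items requested since the last
   request of w that lie strictly deeper than w in Opt's tree.  Initially Opt's tree is an
   MRU tree, so Phi = 0.
   Access of v: at most 2^(d(v)+1) - 1 items have depth at most d(v), so a large rank of v forces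
   a large b(v); the drop of the term of v to 0 therefore pays for log2 rank(v) up to d(v) + 1
   (up to 0 if d(v) = 0).  The terms of the items w above v grow by at most 2 / 2^d(w), which
   sums to at most 2 per level.
   Swap: the term of the item moving up grows by at most 2, and those of the other items on
   its new level by at most 2 in total. *)

theory Submission
  imports Defs
begin

subsection \<open>Levels and depths\<close>

text \<open>The amortized estimates see a tree only through its depth function and this bound on
  level sizes.\<close>

definition level_bounded :: "'a set \<Rightarrow> ('a \<Rightarrow> nat) \<Rightarrow> bool" where
  "level_bounded V d \<longleftrightarrow> finite V \<and> (\<forall>k. card {w\<in>V. d w = k} \<le> 2 ^ k)"

lemma card_level_le: "level_bounded V d \<Longrightarrow> card {w\<in>V. d w = k} \<le> 2 ^ k"
  by (simp add: level_bounded_def)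

lemma card_depth_le:
  assumes "level_bounded V d"
  shows "card {w\<in>V. d w \<le> k} < 2 ^ Suc k"
proof (induction k)
  case 0
  then show ?case using assms by (auto simp: level_bounded_def dest: spec[of _ 0])
next
  case (Suc k)
  have "{w\<in>V. d w \<le> Suc k} = {w\<in>V. d w \<le> k} \<union> {w\<in>V. d w = Suc k}" by auto
  then have "card {w\<in>V. d w \<le> Suc k} \<le> card {w\<in>V. d w \<le> k} + card {w\<in>V. d w = Suc k}"
    by (simp add: card_Un_le)
  moreover have "card {w\<in>V. d w = Suc k} \<le> 2 ^ Suc k"
    using assms by (rule card_level_le)
  ultimately show ?case using Suc by simp
qed

text \<open>The normalisation by \<open>2 ^ d w\<close> is chosen so that a whole level weighs at
  most 1; amortized costs are then counted in levels.\<close>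

lemma sum_level_le:
  assumes "level_bounded V d"
  shows "(\<Sum>w | w \<in> V \<and> d w = k. 1 / 2 ^ d w) \<le> (1::real)"
proof -
  have "card {w\<in>V. d w = k} \<le> 2 ^ k" using assms by (rule card_level_le)
  then have "real (card {w\<in>V. d w = k}) \<le> 2 ^ k"
    by (metis of_nat_le_iff of_nat_numeral of_nat_power)
  moreover have "(\<Sum>w | w \<in> V \<and> d w = k. 1 / 2 ^ d w) = (\<Sum>w | w \<in> V \<and> d w = k. 1 / 2 ^ k :: real)"
    by (intro sum.cong) auto
  ultimately show ?thesis by simp
qed

lemma sum_levels_below_le:
  assumes "level_bounded V d"
  shows "(\<Sum>w | w \<in> V \<and> d w < D. 1 / 2 ^ d w) \<le> real D"
proof (induction D)
  case (Suc D)
  have fin: "finite V" using assms by (simp add: level_bounded_def)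
  have "{w. w \<in> V \<and> d w < Suc D} = {w. w \<in> V \<and> d w < D} \<union> {w. w \<in> V \<and> d w = D}" by auto
  moreover have "(\<Sum>w\<in>{w. w \<in> V \<and> d w < D} \<union> {w. w \<in> V \<and> d w = D}. 1 / 2 ^ d w) =
      (\<Sum>w | w \<in> V \<and> d w < D. 1 / 2 ^ d w) + (\<Sum>w | w \<in> V \<and> d w = D. 1 / 2 ^ d w :: real)"
    using fin by (intro sum.union_disjoint) auto
  moreover have "(\<Sum>w | w \<in> V \<and> d w = D. 1 / 2 ^ d w) \<le> (1::real)"
    using assms by (rule sum_level_le)
  ultimately show ?case using Suc by (simp only: of_nat_Suc)
qed simp

lemma depth_bounds: "1 \<le> i \<Longrightarrow> 2 ^ depth i \<le> i \<and> i < 2 ^ Suc (depth i)"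
proof (induction i rule: depth.induct)
  case (1 i)
  show ?case
  proof (cases "i \<le> 1")
    case True
    then show ?thesis using 1 by (simp add: depth.simps[of i])
  next
    case False
    then have "2 ^ depth (i div 2) \<le> i div 2 \<and> i div 2 < 2 ^ Suc (depth (i div 2))"
      using 1 by (simp add: parent_def)
    then show ?thesis using False by (auto simp: depth.simps[of i] parent_def)
  qed
qed

text \<open>By \<open>depth_bounds\<close> the servers of depth k lie in an interval of 2^k numbers,
  and a tree map is injective.\<close>

lemma level_bounded_tree:
  assumes "is_tree V n T"
  shows "level_bounded V (\<lambda>w. depth (T w))"
proof -
  have bij: "bij_betw T V {1..n}" using assms by (simp add: is_tree_def)
  have "card {w\<in>V. depth (T w) = k} \<le> 2 ^ k" for k
  proof -
    have "T w \<in> {2 ^ k..<2 ^ Suc k}" if "w \<in> V" "depth (T w) = k" for w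
      using depth_bounds[of "T w"] that bij_betwE[OF bij] by auto
    then have "T ` {w\<in>V. depth (T w) = k} \<subseteq> {2 ^ k..<2 ^ Suc k}" by auto
    moreover have "inj_on T {w\<in>V. depth (T w) = k}"
      using bij by (auto simp: bij_betw_def intro: inj_on_subset)
    ultimately have "card {w\<in>V. depth (T w) = k} \<le> card {2 ^ k..<2 ^ Suc k :: nat}"
      by (intro card_inj_on_le) auto
    then show ?thesis by simp
  qed
  moreover have "finite V" using bij bij_betw_finite by blast
  ultimately show ?thesis by (simp add: level_bounded_def)
qed

lemma is_tree_swap:
  assumes "is_tree V n T" "i \<in> {2..n}"
  shows "is_tree V n (swap i T)"
proof -
  have "parent i \<in> {1..n}" using assms(2) by (auto simp: parent_def)
  then have "bij_betw (transpose i (parent i)) {1..n} {1..n}"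
    using assms(2) by (simp add: bij_betw_def)
  then show ?thesis
    using assms(1) unfolding is_tree_def swap_def by (blast intro: bij_betw_trans)
qed

subsection \<open>The potential\<close>

text \<open>\<open>P w\<close> will be \<open>recent hs w\<close>; keeping it abstract separates the
  counting from the request lists. The cardinality of this set is b(w).\<close>

definition bad :: "('a \<Rightarrow> 'a set) \<Rightarrow> ('a \<Rightarrow> nat) \<Rightarrow> 'a \<Rightarrow> 'a set" where
  "bad P d w = {u \<in> P w. d w < d u}"

definition weight :: "('a \<Rightarrow> 'a set) \<Rightarrow> ('a \<Rightarrow> nat) \<Rightarrow> 'a \<Rightarrow> real" where
  "weight P d w = 1 + card (bad P d w) / 2 ^ d w"

definition potential :: "'a set \<Rightarrow> ('a \<Rightarrow> 'a set) \<Rightarrow> ('a \<Rightarrow> nat) \<Rightarrow> real" where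
  "potential V P d = (\<Sum>w\<in>V. log 2 (weight P d w))"

lemma weight_ge_1: "1 \<le> weight P d w"
  by (simp add: weight_def)

lemma log_weight_nonneg: "0 \<le> log 2 (weight P d w)"
  using weight_ge_1[of P d w] by (subst zero_le_log_cancel_iff) auto

lemma potential_nonneg: "0 \<le> potential V P d"
  unfolding potential_def by (intro sum_nonneg log_weight_nonneg)

section \<open>Growth of a single term of the potential\<close>

lemma log2_add_le:
  assumes "1 \<le> a" "0 \<le> x"
  shows "log 2 (a + x) \<le> log 2 a + 2 * x"
proof -
  have "ln (a + x) = ln a + ln (1 + x / a)"
    using assms by (subst ln_mult_pos[symmetric]) (auto simp: field_simps add_pos_nonneg)
  also have "ln (1 + x / a) \<le> x / a"
    using assms by (intro ln_add_one_self_le_self) auto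
  also have "x / a \<le> x" using assms by (simp add: divide_le_eq mult_left_le mult_le_cancel_left1)
  finally have *: "ln (a + x) \<le> ln a + x" by simp
  \<comment> \<open>The factor 2 is a crude bound for 1 / ln 2; ln 2 \<ge> 1/2 follows from ln z
    \<le> z - 1 at z = 1/2.\<close>
  have "ln (1 / 2 :: real) \<le> 1 / 2 - 1" by (intro ln_le_minus_one) simp
  then have ln2: "1 / 2 \<le> ln (2 :: real)" by (simp add: ln_div)
  then have "x \<le> (2 * x) * ln 2" using assms mult_left_mono[OF ln2, of "2 * x"] by simp
  then have "ln (a + x) \<le> ln a + (2 * x) * ln 2" using * by simp
  then show ?thesis using ln2 by (simp add: log_def field_simps)
qed

lemma log2_mono_add:
  assumes "1 \<le> a" "1 \<le> b" "0 \<le> x" "b \<le> a + x"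
  shows "log 2 b \<le> log 2 a + 2 * x"
proof -
  have "log 2 b \<le> log 2 (a + x)" using assms by simp
  then show ?thesis using log2_add_le[OF assms(1,3)] by simp
qed

text \<open>One additional bad item raises the weight by at most \<open>1 / 2 ^ d w\<close>. An
  access to a deeper item does this to \<open>w\<close>, and so does a swap in which another item
  sinks from the level of \<open>w\<close>.\<close>

lemma log_weight_insert_le:
  assumes "finite (bad P d w)" "bad P' d' w \<subseteq> insert v (bad P d w)" "d' w = d w"
  shows "log 2 (weight P' d' w) \<le> log 2 (weight P d w) + 2 * (1 / 2 ^ d w)"
proof -
  have "card (bad P' d' w) \<le> card (insert v (bad P d w))"
    using assms by (intro card_mono) auto
  also have "\<dots> \<le> Suc (card (bad P d w))" using assms(1) by (simp add: card_insert_if)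
  finally have "real (card (bad P' d' w)) \<le> card (bad P d w) + 1" by simp
  then have "weight P' d' w \<le> weight P d w + 1 / 2 ^ d w"
    using assms(3) by (simp add: weight_def add_divide_distrib[symmetric] divide_right_mono)
  then show ?thesis using weight_ge_1 by (intro log2_mono_add) auto
qed

text \<open>Losing bad items lowers the numerator and sinking raises the denominator. The case of
  growing depth serves the item that a swap moves down.\<close>

lemma log_weight_mono:
  assumes "finite (bad P d w)" "bad P' d' w \<subseteq> bad P d w" "d w \<le> d' w"
  shows "log 2 (weight P' d' w) \<le> log 2 (weight P d w)"
proof -
  have "real (card (bad P' d' w)) \<le> card (bad P d w)"
    using assms by (simp add: card_mono)
  then have "weight P' d' w \<le> weight P d w"
    unfolding weight_def using assms(3) by (intro add_left_mono frac_le) (auto intro: power_increasing)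
  then show ?thesis using weight_ge_1[of P' d' w] weight_ge_1[of P d w] by simp
qed

section \<open>Amortized cost of one access\<close>

lemma log_rank_le:
  assumes lb: "level_bounded V d" and v: "v \<in> V" and Pv: "P v \<subseteq> V - {v}"
  shows "log 2 (Suc (card (P v))) \<le> log 2 (weight P d v) + 2 * real (d v)"
proof -
  have fin: "finite V" using lb by (simp add: level_bounded_def)
  let ?L = "{w\<in>V. d w \<le> d v}"
  have cpos: "0 < card ?L" using v fin by (auto simp: card_gt_0_iff)
  \<comment> \<open>Each item of \<open>P v\<close> is bad or lies in \<open>?L\<close>. Excluding
    \<open>v\<close> and the strictness of \<open>card_depth_le\<close> each save 1, which yields
    rank + 1 \<le> 2^d(v) * (weight + 1).\<close>
  have "P v \<subseteq> bad P d v \<union> (?L - {v})" using Pv by (auto simp: bad_def)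
  moreover have "bad P d v \<subseteq> V" using Pv by (auto simp: bad_def)
  ultimately have "card (P v) \<le> card (bad P d v \<union> (?L - {v}))"
    using fin by (intro card_mono) (auto intro: finite_subset)
  also have "\<dots> \<le> card (bad P d v) + card (?L - {v})" by (rule card_Un_le)
  also have "card (?L - {v}) = card ?L - 1" using v fin by simp
  finally have "card (P v) + 2 \<le> card (bad P d v) + 2 ^ Suc (d v)"
    using card_depth_le[OF lb, of "d v"] cpos by linarith
  then have "real (card (P v) + 2) \<le> real (card (bad P d v) + 2 ^ Suc (d v))"
    by (simp only: of_nat_le_iff)
  then have le: "real (Suc (card (P v))) + 1 \<le> 2 ^ d v * (weight P d v + 1)"
    by (simp add: weight_def distrib_left)
  \<comment> \<open>At depth 0 the two saved units give rank \<le> weight outright. Deeper, weight +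
    1 \<le> 2 * weight leads to d(v) + 1, which is at most 2 * d(v) once d(v) \<ge> 1.\<close>
  show ?thesis
  proof (cases "d v = 0")
    case True
    then show ?thesis using le by simp
  next
    case False
    have "2 ^ d v * (weight P d v + 1) \<le> 2 ^ d v * (2 * weight P d v)"
      using weight_ge_1[of P d v] by (intro mult_left_mono) auto
    then have "real (Suc (card (P v))) \<le> 2 ^ d v * (2 * weight P d v)" using le by linarith
    then have "log 2 (Suc (card (P v))) \<le> log 2 (2 ^ d v * (2 * weight P d v))"
      using weight_ge_1[of P d v] by (subst log_le_cancel_iff) auto
    also have "\<dots> = d v + (1 + log 2 (weight P d v))"
      using weight_ge_1[of P d v] by (simp add: log_mult_pos log_nat_power)
    finally show ?thesis using False by simp
  qed
qed

text \<open>The factor 4 consists of two charges of 2 * d(v): one completes the payment for the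
  logarithm of the rank in \<open>log_rank_le\<close>, the other covers a growth of at most 2 on
  each of the d(v) levels above \<open>v\<close>.\<close>

lemma potential_access:
  assumes lb: "level_bounded V d" and v: "v \<in> V"
    and Pv: "P v \<subseteq> V - {v}" and P: "\<And>w. w \<in> V \<Longrightarrow> P w \<subseteq> V"
    and P': "\<And>w. P' w = (if w = v then {} else insert v (P w))"
  shows "log 2 (Suc (card (P v))) + potential V P' d \<le> 4 * real (d v) + potential V P d"
proof -
  have fin: "finite V" using lb by (simp add: level_bounded_def)
  have finb: "finite (bad P d w)" if "w \<in> V" for w
    using P[OF that] fin by (auto simp: bad_def intro: finite_subset)
  \<comment> \<open>\<open>v\<close> joins \<open>P w\<close> for every other \<open>w\<close>, but
    it becomes bad only for items strictly above it.\<close>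
  have each: "log 2 (weight P' d w)
      \<le> log 2 (weight P d w) + (if d w < d v then 2 * (1 / 2 ^ d w) else 0)"
    if "w \<in> V - {v}" for w
  proof (cases "d w < d v")
    case True
    then show ?thesis
      using that finb log_weight_insert_le[of P d w P' d v] by (auto simp: bad_def P')
  next
    case False
    then show ?thesis
      using that finb log_weight_mono[of P d w P' d] by (auto simp: bad_def P')
  qed
  have "potential V P' d = log 2 (weight P' d v) + (\<Sum>w\<in>V - {v}. log 2 (weight P' d w))"
    unfolding potential_def using fin v by (rule sum.remove)
  \<comment> \<open>The former term of \<open>v\<close> is released completely and becomes available
    to \<open>log_rank_le\<close>.\<close>
  also have "log 2 (weight P' d v) = 0" by (simp add: weight_def bad_def P')
  also have "(\<Sum>w\<in>V - {v}. log 2 (weight P' d w)) \<le>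
      (\<Sum>w\<in>V - {v}. log 2 (weight P d w) + (if d w < d v then 2 * (1 / 2 ^ d w) else 0))"
    using each by (rule sum_mono)
  also have "\<dots> = (\<Sum>w\<in>V - {v}. log 2 (weight P d w)) +
      (\<Sum>w\<in>V - {v}. if d w < d v then 2 * (1 / 2 ^ d w) else 0)"
    by (rule sum.distrib)
  also have "(\<Sum>w\<in>V - {v}. if d w < d v then 2 * (1 / 2 ^ d w) else (0::real)) \<le>
      (\<Sum>w\<in>V. if d w < d v then 2 * (1 / 2 ^ d w) else 0)"
    using fin by (intro sum_mono2) auto
  also have "\<dots> = (\<Sum>w | w \<in> V \<and> d w < d v. 2 * (1 / 2 ^ d w))"
    using fin by (simp add: sum.inter_filter[symmetric])
  also have "\<dots> = 2 * (\<Sum>w | w \<in> V \<and> d w < d v. 1 / 2 ^ d w)"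
    by (simp only: sum_distrib_left)
  also have "\<dots> \<le> 2 * real (d v)" using sum_levels_below_le[OF lb, of "d v"] by simp
  finally have "potential V P' d \<le> (\<Sum>w\<in>V - {v}. log 2 (weight P d w)) + 2 * real (d v)" by simp
  moreover have "potential V P d = log 2 (weight P d v) + (\<Sum>w\<in>V - {v}. log 2 (weight P d w))"
    unfolding potential_def using fin v by (rule sum.remove)
  ultimately show ?thesis using log_rank_le[of V d v P] lb v Pv by simp
qed

section \<open>Amortized cost of one swap\<close>

lemma log_weight_move_up:
  assumes lb: "level_bounded V d'" and P: "P y \<subseteq> V"
    and y: "d y = Suc k" "d' y = k"
    and sub: "bad P d' y \<subseteq> bad P d y \<union> {w\<in>V. d' w = Suc k}"
  shows "log 2 (weight P d' y) \<le> log 2 (weight P d y) + 2"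
proof -
  have fin: "finite V" using lb by (simp add: level_bounded_def)
  then have "finite (bad P d y)" using P by (auto simp: bad_def intro: finite_subset)
  then have "card (bad P d' y) \<le> card (bad P d y \<union> {w\<in>V. d' w = Suc k})"
    using sub fin by (intro card_mono) auto
  also have "\<dots> \<le> card (bad P d y) + card {w\<in>V. d' w = Suc k}" by (rule card_Un_le)
  also have "card {w\<in>V. d' w = Suc k} \<le> 2 ^ Suc k" using lb by (rule card_level_le)
  finally have "card (bad P d' y) \<le> card (bad P d y) + 2 ^ Suc k" by simp
  then have "real (card (bad P d' y)) \<le> real (card (bad P d y) + 2 ^ Suc k)"
    by (simp only: of_nat_le_iff)
  then have "card (bad P d' y) / 2 ^ k \<le> (card (bad P d y) + 2 * 2 ^ k) / (2 ^ k :: real)"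
    by (intro divide_right_mono) auto
  \<comment> \<open>Rising one level halves the denominator, doubling the old fraction, and all of
    level k + 1 may become bad, adding 2^(k+1) / 2^k = 2.\<close>
  then have "weight P d' y \<le> 2 * weight P d y + 1"
    using y by (simp add: weight_def add_divide_distrib)
  \<comment> \<open>A weight is at least 1, so 2 * weight + 1 is at most 4 * weight, and log2 4 =
    2.\<close>
  then have "weight P d' y \<le> 2 ^ 2 * weight P d y" using weight_ge_1[of P d y] by simp
  then have "log 2 (weight P d' y) \<le> log 2 (2 ^ 2 * weight P d y)"
    using weight_ge_1[of P d y] weight_ge_1[of P d' y] by (subst log_le_cancel_iff) auto
  also have "\<dots> = log 2 (2 ^ 2) + log 2 (weight P d y)"
    using weight_ge_1[of P d y] by (intro log_mult_pos) auto
  also have "log 2 (2 ^ 2 :: real) = 2" by (subst log_pow_cancel) auto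
  finally show ?thesis by simp
qed

text \<open>The 4 splits into 2 for the rising item \<open>y\<close> and 2 for level k in total,
  where each remaining item may acquire the sinking \<open>x\<close> as a bad item.\<close>

lemma potential_swap:
  assumes lb: "level_bounded V d" "level_bounded V d'"
    and P: "\<And>w. w \<in> V \<Longrightarrow> P w \<subseteq> V"
    and xy: "x \<in> V" "y \<in> V" and d: "d x = k" "d y = Suc k"
    and d': "d' x = Suc k" "d' y = k" "\<And>w. w \<in> V - {x, y} \<Longrightarrow> d' w = d w"
  shows "potential V P d' \<le> 4 + potential V P d"
proof -
  have fin: "finite V" using lb(1) by (simp add: level_bounded_def)
  have finb: "finite (bad P d w)" if "w \<in> V" for w
    using P[OF that] fin by (auto simp: bad_def intro: finite_subset)
  have xney: "x \<noteq> y" using d by auto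
  have depth': "d' u = (if u = x then Suc k else if u = y then k else d u)" if "u \<in> V" for u
    using that d' by auto
  have each: "log 2 (weight P d' w) \<le> log 2 (weight P d w) + (if w = y then 2 else 0)
      + (if d w = k then 2 * (1 / 2 ^ d w) else 0)" if w: "w \<in> V" for w
  proof -
    \<comment> \<open>Only an item on level k distinguishes depth k from depth k + 1 in the test for
      bad items, so the exchange is invisible to bystanders on all other levels.\<close>
    consider "w = x" | "w = y" | "w \<noteq> x" "w \<noteq> y" "d w = k" | "w \<noteq> x" "w \<noteq> y" "d w \<noteq> k" by blast
    then show ?thesis
    proof cases
      case 1
      have "d u > k" if "u \<in> P x" "d' u > Suc k" for u
        using that P[OF xy(1)] depth'[of u] d by (auto split: if_splits)
      then have "bad P d' x \<subseteq> bad P d x" using d d' by (auto simp: bad_def)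
      then have "log 2 (weight P d' x) \<le> log 2 (weight P d x)"
        using finb[OF xy(1)] d d' by (intro log_weight_mono) auto
      then show ?thesis using 1 xney by (simp add: add_increasing2)
    next
      case 2
      have "u \<in> V \<and> (d u > Suc k \<or> d' u = Suc k)" if "u \<in> P y" "d' u > k" for u
        using that P[OF xy(2)] depth'[of u] by (auto split: if_splits)
      then have "bad P d' y \<subseteq> bad P d y \<union> {w\<in>V. d' w = Suc k}"
        using d d' by (auto simp: bad_def)
      then have "log 2 (weight P d' y) \<le> log 2 (weight P d y) + 2"
        using lb(2) P[OF xy(2)] d(2) d'(2) by (intro log_weight_move_up) auto
      then show ?thesis using 2 d by simp
    next
      case 3
      have "u = x \<or> d w < d u" if "u \<in> P w" "d' w < d' u" for u
        using that 3 P[OF w] depth'[OF w] depth'[of u] d by (auto split: if_splits)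
      then have "bad P d' w \<subseteq> insert x (bad P d w)" by (auto simp: bad_def)
      then show ?thesis
        using log_weight_insert_le[of P d w P d' x] finb[OF w] 3 depth'[OF w] by simp
    next
      case 4
      have "d w < d u" if "u \<in> P w" "d' w < d' u" for u
        using that 4 P[OF w] depth'[OF w] depth'[of u] d by (auto split: if_splits)
      then have "bad P d' w \<subseteq> bad P d w" by (auto simp: bad_def)
      then show ?thesis
        using log_weight_mono[of P d w P d'] finb[OF w] 4 depth'[OF w] by simp
    qed
  qed
  have "potential V P d' \<le> (\<Sum>w\<in>V. log 2 (weight P d w) + (if w = y then 2 else 0)
      + (if d w = k then 2 * (1 / 2 ^ d w) else 0))"
    unfolding potential_def using each by (rule sum_mono)
  also have "\<dots> = potential V P d + 2 + (\<Sum>w\<in>V. if d w = k then 2 * (1 / 2 ^ d w) else 0)"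
    using fin xy by (simp add: sum.distrib potential_def)
  also have "(\<Sum>w\<in>V. if d w = k then 2 * (1 / 2 ^ d w) else 0) =
      2 * (\<Sum>w | w \<in> V \<and> d w = k. 1 / 2 ^ d w :: real)"
    using fin by (simp add: sum_distrib_left sum.inter_filter[symmetric])
  also have "\<dots> \<le> 2 * 1" using lb(1) by (intro mult_left_mono sum_level_le) auto
  finally show ?thesis by simp
qed

lemma potential_swap_tree:
  assumes T: "is_tree V n T" and i: "i \<in> {2..n}" and P: "\<And>w. w \<in> V \<Longrightarrow> P w \<subseteq> V"
  shows "potential V P (\<lambda>w. depth (swap i T w)) \<le> 4 + potential V P (\<lambda>w. depth (T w))"
proof -
  have bij: "bij_betw T V {1..n}" using T by (simp add: is_tree_def)
  have "i \<in> T ` V" "parent i \<in> T ` V"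
    using bij i by (auto simp: bij_betw_def parent_def)
  then obtain x y where xy: "x \<in> V" "y \<in> V" "T x = parent i" "T y = i" by auto
  have di: "depth i = Suc (depth (parent i))" using i by (subst depth.simps) auto
  have other: "T w \<noteq> i" "T w \<noteq> parent i" if "w \<in> V - {x, y}" for w
    using that xy bij by (auto simp: bij_betw_def inj_on_def)
  show ?thesis
  proof (rule potential_swap[where x = x and y = y and k = "depth (parent i)"])
    show "level_bounded V (\<lambda>w. depth (T w))" "level_bounded V (\<lambda>w. depth (swap i T w))"
      using T is_tree_swap[OF T i] by (blast intro: level_bounded_tree)+
    show "depth (swap i T w) = depth (T w)" if "w \<in> V - {x, y}" for w
      using other[OF that] by (simp add: swap_def)
  qed (use P xy di in \<open>simp_all add: swap_def\<close>)
qed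

subsection \<open>Ranks\<close>

text \<open>The set counted by \<open>rank\<close> without \<open>w\<close> itself, so that a
  request of \<open>w\<close> resets it to empty. If \<open>w\<close> is absent from
  \<open>hs\<close>, it is all of \<open>set hs\<close>.\<close>

definition recent :: "'a list \<Rightarrow> 'a \<Rightarrow> 'a set" where
  "recent hs w = set (takeWhile (\<lambda>u. u \<noteq> w) (rev hs))"

lemma rank_eq_recent: "rank hs w = Suc (card (recent hs w))"
proof -
  have "w \<notin> recent hs w" by (auto simp: recent_def dest: set_takeWhileD)
  then show ?thesis by (simp add: rank_def recent_def)
qed

text \<open>This is the update from \<open>P\<close> to \<open>P'\<close> required in
  \<open>potential_access\<close>.\<close>

lemma recent_snoc: "recent (hs @ [v]) w = (if w = v then {} else insert v (recent hs w))"
  by (auto simp: recent_def)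

lemma recent_subset: "recent hs w \<subseteq> set hs - {w}"
  by (auto simp: recent_def dest: set_takeWhileD)

text \<open>Since \<open>u\<close> is met before the first \<open>w\<close>, the scan for
  \<open>u\<close> stops earlier.\<close>

lemma takeWhile_before_subset:
  assumes "u \<in> set (takeWhile (\<lambda>x. x \<noteq> w) xs)"
  shows "set (takeWhile (\<lambda>x. x \<noteq> u) xs) \<subseteq> set (takeWhile (\<lambda>x. x \<noteq> w) xs)"
  using assms by (induction xs) (auto split: if_splits)

lemma rank_mono_recent:
  assumes "u \<in> recent hs w"
  shows "rank hs u \<le> rank hs w"
proof -
  have "recent hs u \<subseteq> recent hs w"
    using assms unfolding recent_def by (rule takeWhile_before_subset)
  then show ?thesis unfolding rank_eq_recent by (auto simp: recent_def intro: card_mono)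
qed

section \<open>Lower bound on the cost of every offline schedule\<close>

lemma serves_lower_bound:
  assumes "serves n T \<sigma> c" "is_tree V n T" "set hs \<subseteq> V" "set \<sigma> \<subseteq> V"
  shows "(\<Sum>t<length \<sigma>. log 2 (rank (hs @ take t \<sigma>) (\<sigma> ! t)))
    \<le> 4 * real c + potential V (recent hs) (\<lambda>w. depth (T w))"
  using assms
\<comment> \<open>Induction along the schedule telescopes the potential. \<open>hs\<close> must vary
  because an access extends the history; an adjustment changes only the tree.\<close>
proof (induction arbitrary: hs rule: serves.induct)
  case (finished T)
  then show ?case by (simp add: potential_nonneg)
next
  case (access T \<sigma> c v)
  let ?d = "\<lambda>w. depth (T w)"
  have "log 2 (rank hs v) + potential V (recent (hs @ [v])) ?d
      \<le> 4 * real (depth (T v)) + potential V (recent hs) ?d"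
    unfolding rank_eq_recent
  proof (rule potential_access[where d = ?d])
    show "level_bounded V ?d" using access.prems(1) by (rule level_bounded_tree)
    show "recent hs v \<subseteq> V - {v}" "recent hs w \<subseteq> V" for w
      using recent_subset[of hs v] recent_subset[of hs w] access.prems(2) by auto
  qed (use access.prems in \<open>auto simp: recent_snoc\<close>)
  moreover have "(\<Sum>t<length \<sigma>. log 2 (rank ((hs @ [v]) @ take t \<sigma>) (\<sigma> ! t)))
      \<le> 4 * real c + potential V (recent (hs @ [v])) ?d"
    using access.prems by (intro access.IH) auto
  \<comment> \<open>Index 0 is split off; for the later indices, the first request \<open>v\<close>
    moves from the prefix of \<open>v # \<sigma>\<close> into the history
    \<open>hs @ [v]\<close>.\<close>
  ultimately show ?case by (simp add: sum.lessThan_Suc_shift del: sum.lessThan_Suc)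
next
  case (adjust i T \<sigma> c)
  have "recent hs w \<subseteq> V" for w using recent_subset[of hs w] adjust.prems(2) by auto
  then have "potential V (recent hs) (\<lambda>w. depth (swap i T w))
      \<le> 4 + potential V (recent hs) (\<lambda>w. depth (T w))"
    using adjust.prems(1) adjust.hyps(1) by (intro potential_swap_tree) auto
  moreover have "(\<Sum>t<length \<sigma>. log 2 (rank (hs @ take t \<sigma>) (\<sigma> ! t)))
      \<le> 4 * real c + potential V (recent hs) (\<lambda>w. depth (swap i T w))"
    using adjust.prems adjust.hyps(1) by (intro adjust.IH is_tree_swap)
  ultimately show ?case by simp
qed

section \<open>Consequences of the MRU property\<close>

lemma potential_MRU_tree:
  assumes "is_MRU_tree V hs T" "set hs \<subseteq> V"
  shows "potential V (recent hs) (\<lambda>w. depth (T w)) = 0"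
proof -
  \<comment> \<open>In an MRU tree depth is one monotone function of rank, and an item requested
    since the last request of \<open>w\<close> has no larger rank. Hence it is not deeper than
    \<open>w\<close>, and no item is bad.\<close>
  have "depth (T u) \<le> depth (T w)" if w: "w \<in> V" and u: "u \<in> recent hs w" for u w
  proof -
    have uV: "u \<in> V" using u recent_subset[of hs w] assms(2) by auto
    have "log 2 (real (rank hs u)) \<le> log 2 (real (rank hs w))"
    proof (rule log_mono)
      show "0 < real (rank hs u)" by (simp add: rank_eq_recent)
    qed (use rank_mono_recent[OF u] in simp_all)
    then have "\<lfloor>log 2 (real (rank hs u))\<rfloor> \<le> \<lfloor>log 2 (real (rank hs w))\<rfloor>" by (rule floor_mono)
    moreover have "int (depth (T u)) = \<lfloor>log 2 (real (rank hs u))\<rfloor>"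
      and "int (depth (T w)) = \<lfloor>log 2 (real (rank hs w))\<rfloor>"
      using assms(1) w uV by (auto simp: is_MRU_tree_def)
    ultimately show ?thesis by linarith
  qed
  then have "bad (recent hs) (\<lambda>w. depth (T w)) w = {}" if "w \<in> V" for w
    using that by (fastforce simp: bad_def)
  then show ?thesis by (simp add: potential_def weight_def)
qed

text \<open>Dropping the floor in the MRU depth leaves a quantity determined by the requests alone,
  so it can be compared with any offline schedule.\<close>

lemma access_cost_le_log_ranks:
  assumes "has_MRU_property V h T\<^sub>0 A" "set \<sigma> \<subseteq> V"
  shows "access_cost A T\<^sub>0 \<sigma> \<le> (\<Sum>t<length \<sigma>. log 2 (rank (h @ take t \<sigma>) (\<sigma> ! t)))"
proof -
  have "depth (tree_at A T\<^sub>0 \<sigma> t (\<sigma> ! t)) \<le> log 2 (rank (h @ take t \<sigma>) (\<sigma> ! t))"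
    if t: "t < length \<sigma>" for t
  proof -
    have "is_MRU_tree V (h @ take t \<sigma>) (tree_at A T\<^sub>0 \<sigma> t)"
      using assms t by (simp add: has_MRU_property_def)
    moreover have "\<sigma> ! t \<in> V" using assms(2) t by auto
    ultimately have "int (depth (tree_at A T\<^sub>0 \<sigma> t (\<sigma> ! t)))
        = \<lfloor>log 2 (rank (h @ take t \<sigma>) (\<sigma> ! t))\<rfloor>"
      by (simp add: is_MRU_tree_def)
    then show ?thesis by linarith
  qed
  then show ?thesis unfolding access_cost_def by (auto intro: sum_mono)
qed

theorem theorem4:
  fixes V :: "'a set" and n :: nat and T\<^sub>0 :: "'a tree" and h :: "'a list"
    and A :: "'a online_alg"
  assumes "finite V" and "card V = n"
    and "is_tree V n T\<^sub>0"
    and "is_online_alg V n A"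
    and "set h = V"
    and "has_MRU_property V h T\<^sub>0 A"
  shows "access_competitive 4 V n T\<^sub>0 A"
  unfolding access_competitive_def
proof (intro allI impI)
  fix \<sigma> :: "'a list"
  assume \<sigma>: "set \<sigma> \<subseteq> V"
  \<comment> \<open>The MRU property at time 0 concerns the common initial tree, so Opt also starts
    with potential 0 and no additive constant arises.\<close>
  have "is_MRU_tree V h T\<^sub>0"
    using assms(6) by (auto simp: has_MRU_property_def dest: spec[of _ "[]"])
  then have "potential V (recent h) (\<lambda>w. depth (T\<^sub>0 w)) = 0"
    using assms(5) by (intro potential_MRU_tree) auto
  then show "access_cost A T\<^sub>0 \<sigma> \<le> 4 * real (opt_cost n T\<^sub>0 \<sigma>)"
    using access_cost_le_log_ranks[OF assms(6) \<sigma>]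
      serves_lower_bound[OF serves_opt_cost assms(3) _ \<sigma>, of h] assms(5) by simp
qed

end
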